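(* Let $v:\mathbb{R}\to[0,\infty)$ be an arbitrage-free total implied volatility with $v\in C^1(\mathbb{R})$ and $v(k)>0$ for every $k\in\mathbb{R}$. Let $h\in C^0(\mathbb{R})$ be the unique strictly positive function such that $$v(k)=\frac{1}{\frac1k\int_0^k\frac{1}{h(y)}\,dy}\quad\text{for all }k\neq0,\qquad v(0)=h(0).$$ Let $f_{1/2}(k)=\frac{k}{v(k)}$, let $g_{1/2}=f_{1/2}^{-1}:\mathbb{R}\to\mathbb{R}$ be its inverse, and set $v_{1/2}(z):=v(g_{1/2}(z))$ and $h_{1/2}(z):=h(g_{1/2}(z))$ for $z\in\mathbb{R}$. Then the log-strike transformation $k\mapsto z=f_{1/2}(k)$ maps the harmonic mean representation $v(k)=\Bigl(\frac1k\int_0^k\frac{1}{h(y)}\,dy\Bigr)^{-1}$, $k\neq0$, of $v$ into the arithmetic mean representation $$v_{1/2}(z)=\frac1z\int_0^z h_{1/2}(y)\,dy\qquad\text{for all } z\neq0.$$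
   Context: Let $N$ be the standard Gaussian cumulative distribution function. The normalized Black-Scholes call price $c_{\mathrm{BS}}:\mathbb{R}\times[0,\infty)\to[0,\infty)$ is $$c_{\mathrm{BS}}(k,v)=N(d_1(k,v))-e^kN(d_0(k,v))\ \text{ if } v>0,\qquad c_{\mathrm{BS}}(k,0)=(1-e^k)^+,$$ where $d_0(k,v)=-\frac kv-\frac v2$ and $d_1(k,v)=-\frac kv+\frac v2$ for $v>0$. A function $v:\mathbb{R}\to[0,\infty)$ is an arbitrage-free total implied volatility if the function $K\in(0,\infty)\mapsto C(K):=c_{\mathrm{BS}}\bigl(\log\frac KF,v(\log\frac KF)\bigr)$ is convex and satisfies $\lim_{K\to\infty}C(K)=0$ for some (equivalently, any) $F>0$. For an arbitrage-free total implied volatility $v$ that is $C^1$ and strictly positive, it is known that there exists a unique strictly positive function $h\in C^0(\mathbb{R})$ such that $v(k)=\Bigl(\frac1k\int_0^k\frac{1}{h(y)}\,dy\Bigr)^{-1}$ for all $k\neq0$ and $v(0)=h(0)$, and that $f_{1/2}(k)=\frac{k}{v(k)}$ is a strictly increasing bijection from $\mathbb{R}$ onto $\mathbb{R}$. *)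

theory Defs
  imports "HOL-Probability.Probability"
begin

abbreviation std_normal_cdf :: "real \<Rightarrow> real" where
  "std_normal_cdf \<equiv> cdf std_normal_distribution"

definition d0 :: "real \<Rightarrow> real \<Rightarrow> real" where
  "d0 k v = - (k / v) - v / 2"

definition d1 :: "real \<Rightarrow> real \<Rightarrow> real" where
  "d1 k v = - (k / v) + v / 2"

(* The second argument is a total volatility (volatility times the square root of maturity),
   not a total variance.  Only values v \<ge> 0 are meaningful. *)
definition c_BS :: "real \<Rightarrow> real \<Rightarrow> real" where
  "c_BS k v =
     (if v > 0 then std_normal_cdf (d1 k v) - exp k * std_normal_cdf (d0 k v)
      else max 0 (1 - exp k))"

(* The choice of the forward F > 0 is immaterial: changing it only rescales the strike axis. *)
definition arbitrage_free_total_implied_vol :: "(real \<Rightarrow> real) \<Rightarrow> bool" where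
  "arbitrage_free_total_implied_vol v \<longleftrightarrow>
     (\<forall>k. 0 \<le> v k) \<and>
     (\<exists>F>0. convex_on {0<..} (\<lambda>K. c_BS (ln (K / F)) (v (ln (K / F)))) \<and>
            ((\<lambda>K. c_BS (ln (K / F)) (v (ln (K / F)))) \<longlongrightarrow> 0) at_top)"

definition f_half :: "(real \<Rightarrow> real) \<Rightarrow> real \<Rightarrow> real" where
  "f_half v k = k / v k"

(* Meaningful because f_half v is a bijection of the real line when v is a strictly positive
   arbitrage-free total implied volatility of class C^1. *)
definition g_half :: "(real \<Rightarrow> real) \<Rightarrow> real \<Rightarrow> real" where
  "g_half v = inv (f_half v)"

definition v_half :: "(real \<Rightarrow> real) \<Rightarrow> real \<Rightarrow> real" where
  "v_half v z = v (g_half v z)"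

(* The change of variable is the one determined by v; h is transported along it. *)
definition h_half :: "(real \<Rightarrow> real) \<Rightarrow> (real \<Rightarrow> real) \<Rightarrow> real \<Rightarrow> real" where
  "h_half v h z = h (g_half v z)"

end

theory Submission
  imports Defs "HOL-Complex_Analysis.Conformal_Mappings"
begin

text \<open>
  The harmonic representation says \<open>f_half v k = (LBINT y=0..k. 1 / h y)\<close>, so \<open>f_half v\<close> has
  derivative \<open>1 / h > 0\<close> and its inverse \<open>g\<close> has derivative \<open>h \<circ> g\<close>. Integrating gives
  \<open>g z = (LBINT y=0..z. h (g y))\<close>, and \<open>v (g z) = g z / z\<close>.

  Absence of arbitrage enters only in the surjectivity of \<open>f_half v\<close>. If \<open>f_half v\<close> were bounded
  on a half-line, then \<open>v\<close> would grow linearly there and Gaussian tails would force the call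
  price to \<open>1\<close> faster than any power of the strike. At large strikes this contradicts
  the vanishing of the price. At small strikes it says that the price leaves the value \<open>1\<close> with
  slope \<open>0\<close>, so by convexity it never drops below \<open>1\<close>.
\<close>

section \<open>Exponential bounds for Gaussian tails\<close>

text \<open>Chernoff bound by a change of mean: completing the square, the standard normal density
  is \<open>exp (t * y + t\<^sup>2 / 2)\<close> times the density with mean \<open>- t\<close>,
  which has total mass 1. The sign of \<open>t\<close> is free, so one statement serves both
  tails.\<close>

lemma std_normal_chernoff:
  assumes [measurable]: "A \<in> sets borel" and A: "\<And>y. y \<in> A \<Longrightarrow> t * y \<le> s"
  shows "measure std_normal_distribution A \<le> exp (s + t\<^sup>2 / 2)"
proof -
  have tilt: "std_normal_density y * indicator A y \<le> exp (s + t\<^sup>2 / 2) * normal_density (- t) 1 y" for y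
  proof (cases "y \<in> A")
    case True
    have "std_normal_density y = exp (t * y + t\<^sup>2 / 2) * normal_density (- t) 1 y"
      unfolding normal_density_def
      by (simp add: exp_add[symmetric] power2_eq_square field_simps)
    also have "\<dots> \<le> exp (s + t\<^sup>2 / 2) * normal_density (- t) 1 y"
      using A[OF True] by (intro mult_right_mono) auto
    finally show ?thesis using True by simp
  qed simp
  have "emeasure std_normal_distribution A
      = (\<integral>\<^sup>+ y. ennreal (std_normal_density y * indicator A y) \<partial>lborel)"
    by (simp add: emeasure_density ennreal_mult' ennreal_indicator)
  also have "\<dots> \<le> (\<integral>\<^sup>+ y. ennreal (exp (s + t\<^sup>2 / 2) * normal_density (- t) 1 y) \<partial>lborel)"
    by (intro nn_integral_mono ennreal_leI tilt)
  also have "\<dots> = ennreal (exp (s + t\<^sup>2 / 2))"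
    by (subst nn_integral_eq_integral) auto
  finally show ?thesis
    by (simp add: measure_def enn2real_leI)
qed

interpretation std_normal: real_distribution std_normal_distribution
  by (rule real_dist_normal_dist)

lemma std_normal_cdf_le_exp:
  assumes "0 \<le> t"
  shows "std_normal_cdf x \<le> exp (t * x + t\<^sup>2 / 2)"
  unfolding cdf_def using assms by (intro std_normal_chernoff) (auto intro: mult_left_mono)

lemma one_minus_std_normal_cdf_le_exp:
  assumes "0 \<le> t"
  shows "1 - std_normal_cdf x \<le> exp (- t * x + t\<^sup>2 / 2)"
proof -
  have "1 - std_normal_cdf x = measure std_normal_distribution (space std_normal_distribution - {..x})"
    unfolding cdf_def by (rule std_normal.prob_compl[symmetric]) simp
  also have "space std_normal_distribution - {..x} = {x<..}"
    by auto
  also have "measure std_normal_distribution {x<..} \<le> exp (- t * x + (- t)\<^sup>2 / 2)"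
    using assms by (intro std_normal_chernoff) (auto intro!: mult_left_mono)
  finally show ?thesis by simp
qed

section \<open>Distance of the call price from 1\<close>

lemma c_BS_le_1: "0 < v \<Longrightarrow> c_BS k v \<le> 1"
  using std_normal.cdf_bounded_prob[of "d1 k v"]
    mult_nonneg_nonneg[OF exp_ge_zero std_normal.cdf_nonneg, of k "d0 k v"]
  unfolding c_BS_def by simp

text \<open>Since \<open>k / v\<close> stays within \<open>M\<close> while \<open>v / 2\<close>
  grows at least like \<open>\<bar>k\<bar> / (2 * M)\<close>, \<open>d1\<close> is large and
  \<open>d0\<close> very negative. Each Gaussian term is then exponentially small, and the factors 1
  and \<open>exp k\<close> are their weights in the price. Decay rate 2 suits both wings: the bound
  vanishes as k tends to infinity, and near strike zero it is quadratic in the strike.\<close>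

lemma one_minus_c_BS_le:
  assumes "0 < v" "0 < M" "\<bar>k\<bar> \<le> M * v"
  shows "1 - c_BS k v \<le> exp (12 * M\<^sup>2) * (1 + exp k) * exp (- 2 * \<bar>k\<bar>)"
proof -
  \<comment> \<open>This tilt balances the linear growth \<open>v / 2 \<ge> \<bar>k\<bar> / (2 * M)\<close> so as to beat \<open>exp k\<close>.\<close>
  define t where "t = 4 * M"
  have t: "0 \<le> t" using assms by (simp add: t_def)
  have kv: "\<bar>k / v\<bar> \<le> M"
    using assms by (simp add: field_simps)
  have v: "\<bar>k\<bar> / (2 * M) \<le> v / 2"
    using assms by (simp add: field_simps)
  have tk: "t * (\<bar>k\<bar> / (2 * M)) = 2 * \<bar>k\<bar>"
    using assms by (simp add: t_def)
  have tM: "t * M + t\<^sup>2 / 2 = 12 * M\<^sup>2"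
    by (simp add: t_def power2_eq_square)
  have d1: "\<bar>k\<bar> / (2 * M) - M \<le> d1 k v"
    and d0: "d0 k v \<le> M - \<bar>k\<bar> / (2 * M)"
    using kv v unfolding d1_def d0_def by linarith+
  have d1': "- t * d1 k v + t\<^sup>2 / 2 \<le> 12 * M\<^sup>2 + - 2 * \<bar>k\<bar>"
    using mult_left_mono[OF d1 t] tk tM by (simp add: right_diff_distrib)
  have d0': "t * d0 k v + t\<^sup>2 / 2 \<le> 12 * M\<^sup>2 + - 2 * \<bar>k\<bar>"
    using mult_left_mono[OF d0 t] tk tM by (simp add: right_diff_distrib)
  have "1 - std_normal_cdf (d1 k v) \<le> exp (12 * M\<^sup>2 + - 2 * \<bar>k\<bar>)"
    using one_minus_std_normal_cdf_le_exp[OF t, of "d1 k v"] d1' by (meson exp_le_cancel_iff order_trans)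
  moreover have "std_normal_cdf (d0 k v) \<le> exp (12 * M\<^sup>2 + - 2 * \<bar>k\<bar>)"
    using std_normal_cdf_le_exp[OF t, of "d0 k v"] d0' by (meson exp_le_cancel_iff order_trans)
  then have "exp k * std_normal_cdf (d0 k v) \<le> exp k * exp (12 * M\<^sup>2 + - 2 * \<bar>k\<bar>)"
    by (intro mult_left_mono) auto
  ultimately have "1 - c_BS k v \<le> exp (12 * M\<^sup>2 + - 2 * \<bar>k\<bar>) + exp k * exp (12 * M\<^sup>2 + - 2 * \<bar>k\<bar>)"
    unfolding c_BS_def if_P[OF \<open>0 < v\<close>] by linarith
  then show ?thesis
    by (simp add: exp_diff exp_minus field_simps)
qed

text \<open>A value below 1 at b would, through the chord from near 0 to b, keep
  \<open>(1 - \<phi> a) / a\<close> above a positive constant for all small a, against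
  flatness.\<close>

lemma convex_ge_1_if_flat_at_0:
  fixes \<phi> :: "real \<Rightarrow> real"
  assumes convex: "convex_on {0<..} \<phi>"
    and le1: "\<And>x. 0 < x \<Longrightarrow> \<phi> x \<le> 1"
    and flat: "((\<lambda>x. (1 - \<phi> x) / x) \<longlongrightarrow> 0) (at_right 0)"
    and "0 < b"
  shows "1 \<le> \<phi> b"
proof (rule ccontr)
  assume "\<not> 1 \<le> \<phi> b"
  then have \<epsilon>: "0 < (1 - \<phi> b) / (2 * b)"
    using \<open>0 < b\<close> by simp
  have "\<forall>\<^sub>F a in at_right 0. (1 - \<phi> a) / a < (1 - \<phi> b) / (2 * b)"
    using order_tendstoD(2)[OF flat \<epsilon>] .
  moreover have "\<forall>\<^sub>F a in at_right 0. a \<in> {0<..<b}"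
    by (rule eventually_at_rightI[of 0 b]) (use \<open>0 < b\<close> in auto)
  ultimately have "\<forall>\<^sub>F a in at_right 0. (1 - \<phi> a) / a < (1 - \<phi> b) / (2 * b) \<and> a \<in> {0<..<b}"
    by (rule eventually_conj)
  then obtain a where a: "(1 - \<phi> a) / a < (1 - \<phi> b) / (2 * b)" "0 < a" "a < b"
    using eventually_happens'[OF trivial_limit_at_right_real] by fastforce
  \<comment> \<open>The point 0 lies outside the domain of convexity, so the chord starts at
    \<open>a / 2\<close>, and \<open>l\<close> is the weight of \<open>b\<close> that puts
    \<open>a\<close> on it. Starting there instead of at 0 is paid for by the factor 2 in the
    threshold \<open>(1 - \<phi> b) / (2 * b)\<close>.\<close>
  define l where "l = (a / 2) / (b - a / 2)"
  have l: "a / (2 * b) \<le> l" "0 \<le> l" "l \<le> 1"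
    using a by (simp_all add: l_def field_simps)
  have "l * (b - a / 2) = a / 2"
    unfolding l_def by (rule nonzero_eq_divide_eq[THEN iffD1, OF _ refl]) (use a in simp)
  then have l_eq: "(1 - l) * (a / 2) + l * b = a"
    by (simp add: left_diff_distrib right_diff_distrib diff_divide_distrib)
  have "\<phi> a \<le> (1 - l) * \<phi> (a / 2) + l * \<phi> b"
    using convex_onD[OF convex, of l "a / 2" b] l l_eq a \<open>0 < b\<close> by simp
  also have "\<dots> \<le> (1 - l) * 1 + l * \<phi> b"
    using le1[of "a / 2"] l a by (intro add_mono mult_left_mono) auto
  finally have "l * (1 - \<phi> b) \<le> 1 - \<phi> a"
    by (simp add: algebra_simps)
  moreover have "a / (2 * b) * (1 - \<phi> b) \<le> l * (1 - \<phi> b)"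
    using l \<open>\<not> 1 \<le> \<phi> b\<close> by (intro mult_right_mono) auto
  ultimately have "a / (2 * b) * (1 - \<phi> b) \<le> 1 - \<phi> a"
    by linarith
  with a \<open>0 < b\<close> show False
    by (simp add: field_simps)
qed

section \<open>Absence of arbitrage makes \<open>f_half v\<close> unbounded on both sides\<close>

lemma arbitrage_free_f_half_unbounded_above:
  assumes af: "arbitrage_free_total_implied_vol v" and pos: "\<And>k. 0 < v k"
  shows "\<exists>k>0. M < f_half v k"
proof (rule ccontr)
  assume bounded: "\<not> (\<exists>k>0. M < f_half v k)"
  \<comment> \<open>The maximum with 1 makes the bound positive, as \<open>one_minus_c_BS_le\<close>
    requires.\<close>
  define L where "L = max M 1"
  have "0 < L" by (simp add: L_def)
  have kv: "\<bar>k\<bar> \<le> L * v k" if "0 < k" for k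
  proof -
    have "k / v k \<le> L"
      using bounded that by (fastforce simp: f_half_def L_def not_less)
    with pos[of k] that show ?thesis
      by (simp add: field_simps)
  qed
  from af obtain F where F: "0 < F"
    and lim: "((\<lambda>K. c_BS (ln (K / F)) (v (ln (K / F)))) \<longlongrightarrow> 0) at_top"
    by (auto simp: arbitrage_free_total_implied_vol_def)
  \<comment> \<open>The substitution \<open>K = F * exp k\<close> moves the limit from strikes to
    log-strikes.\<close>
  have "filterlim (\<lambda>k. F * exp k) at_top at_top"
    using F by (intro filterlim_tendsto_pos_mult_at_top[OF tendsto_const] exp_at_top)
  from filterlim_compose[OF lim this] have "((\<lambda>k. c_BS k (v k)) \<longlongrightarrow> 0) at_top"
    using F by simp
  then have "((\<lambda>k. 1 - c_BS k (v k)) \<longlongrightarrow> 1 - 0) at_top"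
    by (intro tendsto_intros)
  moreover have "((\<lambda>k. exp (12 * L\<^sup>2) * (1 + exp k) * exp (- 2 * \<bar>k\<bar>)) \<longlongrightarrow> 0) at_top"
  proof -
    have e: "((\<lambda>k::real. exp (- k)) \<longlongrightarrow> 0) at_top"
      by (intro filterlim_compose[OF exp_at_bot] filterlim_uminus_at_bot_at_top)
    have "((\<lambda>k. exp (12 * L\<^sup>2) * (exp (- k) * exp (- k) + exp (- k))) \<longlongrightarrow>
        exp (12 * L\<^sup>2) * (0 * 0 + 0)) at_top"
      by (intro tendsto_mult tendsto_add tendsto_const e)
    moreover have "\<forall>\<^sub>F k in at_top. exp (12 * L\<^sup>2) * (exp (- k) * exp (- k) + exp (- k))
        = exp (12 * L\<^sup>2) * (1 + exp k) * exp (- 2 * \<bar>k\<bar>)"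
      using eventually_ge_at_top[of "0::real"]
      by eventually_elim (simp add: exp_add[symmetric] distrib_left distrib_right mult.assoc)
    ultimately show ?thesis
      using Lim_transform_eventually by fastforce
  qed
  moreover have "\<forall>\<^sub>F k in at_top. 1 - c_BS k (v k) \<le> exp (12 * L\<^sup>2) * (1 + exp k) * exp (- 2 * \<bar>k\<bar>)"
    using eventually_gt_at_top[of 0]
    by eventually_elim (intro one_minus_c_BS_le pos \<open>0 < L\<close> kv)
  ultimately have "(1::real) - 0 \<le> 0"
    by (intro tendsto_le[OF trivial_limit_at_top_linorder])
  then show False by simp
qed

lemma arbitrage_free_f_half_unbounded_below:
  assumes af: "arbitrage_free_total_implied_vol v" and pos: "\<And>k. 0 < v k"
  shows "\<exists>k<0. f_half v k < M"
proof (rule ccontr)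
  assume bounded: "\<not> (\<exists>k<0. f_half v k < M)"
  define L where "L = max (- M) 1"
  have "0 < L" by (simp add: L_def)
  have kv: "\<bar>k\<bar> \<le> L * v k" if "k < 0" for k
  proof -
    have "- L \<le> k / v k"
      using bounded that by (fastforce simp: f_half_def L_def not_less)
    with pos[of k] that show ?thesis
      by (simp add: field_simps)
  qed
  from af obtain F where F: "0 < F"
    and convex: "convex_on {0<..} (\<lambda>K. c_BS (ln (K / F)) (v (ln (K / F))))"
    and lim: "((\<lambda>K. c_BS (ln (K / F)) (v (ln (K / F)))) \<longlongrightarrow> 0) at_top"
    by (auto simp: arbitrage_free_total_implied_vol_def)
  define C where "C = (\<lambda>K. c_BS (ln (K / F)) (v (ln (K / F))))"
  have C_le: "C K \<le> 1" for K
    unfolding C_def by (intro c_BS_le_1 pos)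
  \<comment> \<open>As \<open>exp k = K / F\<close>, the factor
    \<open>exp (- 2 * \<bar>k\<bar>)\<close> is quadratic in the strike, so one power of
    \<open>K\<close> survives the division.\<close>
  have bound: "(1 - C K) / K \<le> 2 * exp (12 * L\<^sup>2) / F\<^sup>2 * K" if K: "0 < K" "K < F" for K
  proof -
    define k where "k = ln (K / F)"
    have ek: "exp k = K / F" and k: "k < 0"
      using K F by (simp_all add: k_def)
    have "1 - C K \<le> exp (12 * L\<^sup>2) * (1 + exp k) * exp (- 2 * \<bar>k\<bar>)"
      unfolding C_def k_def[symmetric] by (intro one_minus_c_BS_le pos \<open>0 < L\<close> kv k)
    also have "\<dots> \<le> exp (12 * L\<^sup>2) * 2 * exp (- 2 * \<bar>k\<bar>)"
      using k by (intro mult_right_mono mult_left_mono) auto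
    also have "exp (- 2 * \<bar>k\<bar>) = (K / F)\<^sup>2"
      using k by (simp add: ek[symmetric] power2_eq_square exp_add[symmetric])
    finally show ?thesis
      using K F by (simp add: field_simps power2_eq_square)
  qed
  have near0: "\<forall>\<^sub>F K in at_right 0. K \<in> {0<..<F}"
    by (rule eventually_at_rightI[of 0 F]) (use F in auto)
  have "((\<lambda>K. (1 - C K) / K) \<longlongrightarrow> 0) (at_right 0)"
  proof (rule tendsto_sandwich)
    show "\<forall>\<^sub>F K in at_right 0. 0 \<le> (1 - C K) / K"
      using near0 by eventually_elim (simp add: C_le)
    show "\<forall>\<^sub>F K in at_right 0. (1 - C K) / K \<le> 2 * exp (12 * L\<^sup>2) / F\<^sup>2 * K"
      using near0 by eventually_elim (simp only: greaterThanLessThan_iff bound)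
    have "((\<lambda>K. 2 * exp (12 * L\<^sup>2) / F\<^sup>2 * K) \<longlongrightarrow> 2 * exp (12 * L\<^sup>2) / F\<^sup>2 * 0) (at_right 0)"
      by (intro tendsto_intros)
    then show "((\<lambda>K. 2 * exp (12 * L\<^sup>2) / F\<^sup>2 * K) \<longlongrightarrow> 0) (at_right 0)"
      by simp
  qed simp
  \<comment> \<open>The contradiction arises at the other end of the strike axis: a price that is
    nowhere below 1 cannot vanish at infinity.\<close>
  from convex_ge_1_if_flat_at_0[OF convex[folded C_def] C_le this]
  have "\<forall>\<^sub>F K in at_top. 1 \<le> C K"
    using eventually_gt_at_top[of 0] by (rule eventually_mono[rotated])
  from tendsto_lowerbound[OF lim[folded C_def] this] show False
    by simp
qed

section \<open>Calculus of the change of variable\<close>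

lemma DERIV_LBINT:
  fixes f :: "real \<Rightarrow> real"
  assumes "continuous_on UNIV f"
  shows "((\<lambda>u. LBINT y=ereal c..ereal u. f y) has_real_derivative f x) (at x)"
proof -
  \<comment> \<open>The margin of 1 puts \<open>x\<close> in the interior of the interval, whatever
    the order of \<open>c\<close> and \<open>x\<close>, so the derivative within it is the full
    derivative.\<close>
  let ?a = "min c x - 1" and ?b = "max c x + 1"
  have "((\<lambda>u. LBINT y=ereal c..ereal u. f y) has_vector_derivative f x) (at x within {?a..?b})"
    by (intro interval_integral_FTC2 continuous_on_subset[OF assms]) auto
  moreover have "at x within {?a..?b} = at x"
    by (rule at_within_interior) auto
  ultimately show ?thesis
    by (simp add: has_real_derivative_iff_has_vector_derivative)
qed

text \<open>This is where harmonic turns into arithmetic: inverting \<open>f\<close> inverts its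
  derivative \<open>1 / r\<close>, so \<open>g\<close> is an antiderivative of \<open>r\<close>
  composed with \<open>g\<close>.\<close>

lemma LBINT_inverse_function:
  fixes f g r :: "real \<Rightarrow> real"
  assumes f': "\<And>x. (f has_real_derivative 1 / r x) (at x)"
    and r: "continuous_on UNIV r" "\<And>x. r x \<noteq> 0"
    and gf: "\<And>x. g (f x) = x" and fg: "\<And>z. f (g z) = z"
  shows "(LBINT y=ereal a..ereal b. r (g y)) = g b - g a"
proof -
  have "continuous_on UNIV f"
    using f' by (intro continuous_at_imp_continuous_on ballI DERIV_isCont)
  then have "(g has_real_derivative inverse (1 / r (g z))) (at z)" for z
    by (intro has_field_derivative_inverse_strong_x[where f = f and S = UNIV] f')
      (simp_all add: r gf fg)
  then have g': "(g has_real_derivative r (g z)) (at z)" for z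
    by (simp add: inverse_eq_divide)
  then have g: "continuous_on UNIV g"
    by (intro continuous_at_imp_continuous_on ballI DERIV_isCont)
  have "continuous_on A (\<lambda>y. r (g y))" for A
    by (rule continuous_on_compose2[OF r(1) continuous_on_subset[OF g]]) simp_all
  then show ?thesis
    using g'[THEN has_field_derivative_at_within]
    by (intro interval_integral_FTC_finite)
      (simp_all only: has_real_derivative_iff_has_vector_derivative)
qed

theorem proposition3p3:
  fixes v h :: "real \<Rightarrow> real"
  assumes "arbitrage_free_total_implied_vol v"
    and "v C1_differentiable_on UNIV"
    and "\<And>k. v k > 0"
    and "continuous_on UNIV h"
    and "\<And>k. h k > 0"
    and "\<And>k. k \<noteq> 0 \<Longrightarrow> v k = 1 / (1 / k * (LBINT y=0..k. 1 / h y))"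
    and "v 0 = h 0"
  shows "\<forall>z. z \<noteq> 0 \<longrightarrow> v_half v z = 1 / z * (LBINT y=0..z. h_half v h y)"
proof (intro allI impI)
  fix z :: real
  assume "z \<noteq> 0"
  \<comment> \<open>Away from 0 this is the harmonic representation solved for
    \<open>k / v k\<close>; at 0 both sides are 0.\<close>
  have f_eq: "f_half v k = (LBINT y=ereal 0..ereal k. 1 / h y)" for k
    using assms(6)[of k] by (cases "k = 0") (simp_all add: f_half_def zero_ereal_def)
  have "h k \<noteq> 0" for k
    using assms(5)[of k] by simp
  then have f': "(f_half v has_real_derivative 1 / h k) (at k)" for k
    unfolding f_eq by (intro DERIV_LBINT continuous_intros assms(4)) auto
  then have cont: "continuous_on A (f_half v)" for A
    by (intro continuous_at_imp_continuous_on ballI DERIV_isCont)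
  have mono: "f_half v x < f_half v y" if "x < y" for x y
    by (rule DERIV_pos_imp_increasing[OF that]) (use f' assms(5) in \<open>meson divide_pos_pos zero_less_one\<close>)
  then have "inj (f_half v)"
    by (auto intro!: linorder_injI simp: less_imp_neq)
  have "surj (f_half v)"
    unfolding surj_def
  proof
    fix w
    obtain a where "a < 0" "f_half v a < w"
      using arbitrage_free_f_half_unbounded_below[OF assms(1,3)] by blast
    moreover obtain b where "0 < b" "w < f_half v b"
      using arbitrage_free_f_half_unbounded_above[OF assms(1,3)] by blast
    ultimately show "\<exists>k. w = f_half v k"
      using IVT'[of "f_half v" a w b] cont by fastforce
  qed
  have gf: "g_half v (f_half v k) = k" and fg: "f_half v (g_half v w) = w" for k w
    using \<open>inj (f_half v)\<close> \<open>surj (f_half v)\<close> by (simp_all add: g_half_def surj_f_inv_f)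
  \<comment> \<open>This removes the boundary term at 0 from the integral.\<close>
  have "g_half v 0 = 0"
    using gf[of 0] by (simp add: f_half_def)
  then have "(LBINT y=0..z. h_half v h y) = g_half v z"
    using LBINT_inverse_function[OF f' assms(4) _ gf fg, of 0 z] \<open>\<And>k. h k \<noteq> 0\<close>
    by (simp add: h_half_def zero_ereal_def)
  moreover have "v_half v z = g_half v z / z"
    using fg[of z] assms(3)[of "g_half v z"] \<open>z \<noteq> 0\<close>
    by (simp add: f_half_def v_half_def field_simps)
  ultimately show "v_half v z = 1 / z * (LBINT y=0..z. h_half v h y)"
    by simp
qed

end
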